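(* Let $L_1,L_2,L_3$ be non-null lines which are concurrent (they pass through a common point), and let $S_1\equiv S(L_2,L_3)$, $S_2\equiv S(L_1,L_3)$, $S_3\equiv S(L_1,L_2)$ be their spreads. Then $$(S_1+S_2+S_3)^2=2(S_1^2+S_2^2+S_3^2)+4S_1S_2S_3.$$
   Context: Let $\mathbb F$ be a field of characteristic not two. A 3-proportion $x:y:z$ is a triple of elements of $\mathbb F$, not all zero, up to a common non-zero scalar. A point $a=[x:y:z]$ and a line $L=(l:m:n)$ are both 3-proportions. The line $(l:m:n)$ passes through the point $[x:y:z]$ when $lx+my-nz=0$. A line $(l:m:n)$ is null when $l^2+m^2-n^2=0$. The spread between non-null lines $L_1=(l_1:m_1:n_1)$ and $L_2=(l_2:m_2:n_2)$ is $$S(L_1,L_2)=1-\frac{(l_1l_2+m_1m_2-n_1n_2)^2}{(l_1^2+m_1^2-n_1^2)(l_2^2+m_2^2-n_2^2)};$$ it is undefined if either line is null. *)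

theory Defs
  imports Main
begin

definition proportional3 :: "'a::field \<times> 'a \<times> 'a \<Rightarrow> 'a \<times> 'a \<times> 'a \<Rightarrow> bool" where
  "proportional3 u v \<longleftrightarrow>
     (case (u, v) of ((x, y, z), (x', y', z')) \<Rightarrow>
        (x, y, z) \<noteq> (0, 0, 0) \<and> (x', y', z') \<noteq> (0, 0, 0) \<and>
        (\<exists>c. c \<noteq> 0 \<and> x' = c * x \<and> y' = c * y \<and> z' = c * z))"

lemma part_equivp_proportional3: "part_equivp (proportional3 :: 'a::field \<times> 'a \<times> 'a \<Rightarrow> _)"
proof (rule part_equivpI)
  show "\<exists>u. proportional3 u (u :: 'a \<times> 'a \<times> 'a)"
    by (rule exI[of _ "(1, 0, 0)"]) (auto simp: proportional3_def intro!: exI[of _ 1])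
  show "symp (proportional3 :: 'a \<times> 'a \<times> 'a \<Rightarrow> _)"
  proof (rule sympI)
    fix u v :: "'a \<times> 'a \<times> 'a"
    assume uv: "proportional3 u v"
    obtain x y z x' y' z' where [simp]: "u = (x, y, z)" "v = (x', y', z')"
      by (metis prod.exhaust)
    from uv obtain c where "c \<noteq> 0" "x' = c * x" "y' = c * y" "z' = c * z"
      "(x, y, z) \<noteq> (0, 0, 0)"
      by (auto simp: proportional3_def)
    then show "proportional3 v u"
      by (auto simp: proportional3_def intro!: exI[of _ "inverse c"])
  qed
  show "transp (proportional3 :: 'a \<times> 'a \<times> 'a \<Rightarrow> _)"
  proof (rule transpI)
    fix u v w :: "'a \<times> 'a \<times> 'a"
    assume uv: "proportional3 u v" and vw: "proportional3 v w"
    obtain x y z x' y' z' x'' y'' z'' where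
      [simp]: "u = (x, y, z)" "v = (x', y', z')" "w = (x'', y'', z'')"
      by (metis prod.exhaust)
    from uv obtain c where "c \<noteq> 0" "x' = c * x" "y' = c * y" "z' = c * z"
      by (auto simp: proportional3_def)
    moreover from vw obtain d where "d \<noteq> 0" "x'' = d * x'" "y'' = d * y'" "z'' = d * z'"
      by (auto simp: proportional3_def)
    ultimately show "proportional3 u w"
      using uv vw by (auto simp: proportional3_def intro!: exI[of _ "d * c"])
  qed
qed

quotient_type (overloaded) 'a proportion3 = "'a::field \<times> 'a \<times> 'a" / partial: proportional3
  by (rule part_equivp_proportional3)

type_synonym 'a point = "'a proportion3"
type_synonym 'a line = "'a proportion3"

lift_definition passes_through :: "'a::field line \<Rightarrow> 'a point \<Rightarrow> bool" is
  "\<lambda>(l, m, n) (x, y, z). l * x + m * y - n * z = 0"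
proof -
  fix L L' a a' :: "'a \<times> 'a \<times> 'a"
  assume L: "proportional3 L L'" and a: "proportional3 a a'"
  obtain l m n l' m' n' x y z x' y' z' where
    [simp]: "L = (l, m, n)" "L' = (l', m', n')" "a = (x, y, z)" "a' = (x', y', z')"
    by (metis prod.exhaust)
  from L obtain c where c: "c \<noteq> 0" "l' = c * l" "m' = c * m" "n' = c * n"
    by (auto simp: proportional3_def)
  from a obtain d where d: "d \<noteq> 0" "x' = d * x" "y' = d * y" "z' = d * z"
    by (auto simp: proportional3_def)
  have "l' * x' + m' * y' - n' * z' = (c * d) * (l * x + m * y - n * z)"
    by (simp add: c d algebra_simps)
  then show "(case L of (l, m, n) \<Rightarrow> \<lambda>(x, y, z). l * x + m * y - n * z = 0) a =
             (case L' of (l, m, n) \<Rightarrow> \<lambda>(x, y, z). l * x + m * y - n * z = 0) a'"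
    using c(1) d(1) by (simp del: right_minus_eq)
qed

definition concurrent3 :: "'a::field line \<Rightarrow> 'a line \<Rightarrow> 'a line \<Rightarrow> bool" where
  "concurrent3 L1 L2 L3 \<longleftrightarrow>
     (\<exists>a. passes_through L1 a \<and> passes_through L2 a \<and> passes_through L3 a)"

lift_definition null_line :: "'a::field line \<Rightarrow> bool" is
  "\<lambda>(l, m, n). l^2 + m^2 - n^2 = 0"
proof -
  fix L L' :: "'a \<times> 'a \<times> 'a"
  assume L: "proportional3 L L'"
  obtain l m n l' m' n' where [simp]: "L = (l, m, n)" "L' = (l', m', n')"
    by (metis prod.exhaust)
  from L obtain c where c: "c \<noteq> 0" "l' = c * l" "m' = c * m" "n' = c * n"
    by (auto simp: proportional3_def)
  have "l'^2 + m'^2 - n'^2 = c^2 * (l^2 + m^2 - n^2)"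
    by (simp add: c algebra_simps power_mult_distrib)
  then show "(case L of (l, m, n) \<Rightarrow> l^2 + m^2 - n^2 = 0) =
             (case L' of (l, m, n) \<Rightarrow> l^2 + m^2 - n^2 = 0)"
    using c(1) by (simp del: right_minus_eq)
qed

(* Meaningful only for non-null lines: if one of the lines is null, division by zero
   in HOL gives the value 1. *)
lift_definition spread :: "'a::field line \<Rightarrow> 'a line \<Rightarrow> 'a" is
  "\<lambda>(l1, m1, n1) (l2, m2, n2).
     1 - (l1 * l2 + m1 * m2 - n1 * n2)^2 /
         ((l1^2 + m1^2 - n1^2) * (l2^2 + m2^2 - n2^2))"
proof -
  fix L L' K K' :: "'a \<times> 'a \<times> 'a"
  assume L: "proportional3 L L'" and K: "proportional3 K K'"
  obtain l m n l' m' n' p q r p' q' r' where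
    [simp]: "L = (l, m, n)" "L' = (l', m', n')" "K = (p, q, r)" "K' = (p', q', r')"
    by (metis prod.exhaust)
  from L obtain c where c: "c \<noteq> 0" "l' = c * l" "m' = c * m" "n' = c * n"
    by (auto simp: proportional3_def)
  from K obtain d where d: "d \<noteq> 0" "p' = d * p" "q' = d * q" "r' = d * r"
    by (auto simp: proportional3_def)
  have "l' * p' + m' * q' - n' * r' = (c * d) * (l * p + m * q - n * r)"
    by (simp add: c d algebra_simps)
  then have num: "(l' * p' + m' * q' - n' * r')^2 = (c * d)^2 * (l * p + m * q - n * r)^2"
    by (simp add: power_mult_distrib)
  have den: "(l'^2 + m'^2 - n'^2) * (p'^2 + q'^2 - r'^2) =
             (c * d)^2 * ((l^2 + m^2 - n^2) * (p^2 + q^2 - r^2))"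
    by (simp add: c d algebra_simps power_mult_distrib)
  have "(c * d)^2 \<noteq> 0"
    using c(1) d(1) by simp
  then have "(l' * p' + m' * q' - n' * r')^2 / ((l'^2 + m'^2 - n'^2) * (p'^2 + q'^2 - r'^2)) =
             (l * p + m * q - n * r)^2 / ((l^2 + m^2 - n^2) * (p^2 + q^2 - r^2))"
    unfolding num den by (rule mult_divide_mult_cancel_left)
  then show "(case L of (l1, m1, n1) \<Rightarrow> \<lambda>(l2, m2, n2).
        1 - (l1 * l2 + m1 * m2 - n1 * n2)^2 /
            ((l1^2 + m1^2 - n1^2) * (l2^2 + m2^2 - n2^2))) K =
      (case L' of (l1, m1, n1) \<Rightarrow> \<lambda>(l2, m2, n2).
        1 - (l1 * l2 + m1 * m2 - n1 * n2)^2 /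
            ((l1^2 + m1^2 - n1^2) * (l2^2 + m2^2 - n2^2))) K'"
    by simp
qed

end

theory Submission
  imports Defs
begin

text \<open>
  Concurrency makes the three coordinate vectors linearly dependent, so their Gram matrix for the
  form \<open>l\<^sup>2 + m\<^sup>2 - n\<^sup>2\<close> is singular. After division by the product of the diagonal entries,
  this says that \<open>1 - C\<^sub>1 - C\<^sub>2 - C\<^sub>3\<close> equals \<open>-2\<close> times the product of the three normalised
  off-diagonal entries, where \<open>C\<^sub>i = 1 - S\<^sub>i\<close>; squaring gives \<open>(1 - C\<^sub>1 - C\<^sub>2 - C\<^sub>3)\<^sup>2 = 4 C\<^sub>1 C\<^sub>2 C\<^sub>3\<close>,
  which is the claim.
\<close>

text \<open>Cramer's rule: \<open>(x, y, -z)\<close> is a nonzero kernel vector of the matrix with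
  rows \<open>(li, mi, ni)\<close>, so the determinant kills each coordinate.\<close>

lemma concurrent_det_eq_0:
  fixes l1 :: "'a::field"
  assumes "l1 * x + m1 * y - n1 * z = 0" "l2 * x + m2 * y - n2 * z = 0"
    "l3 * x + m3 * y - n3 * z = 0" "(x, y, z) \<noteq> (0, 0, 0)"
  shows "l1 * (m2 * n3 - n2 * m3) - m1 * (l2 * n3 - n2 * l3) + n1 * (l2 * m3 - m2 * l3) = 0"
    (is "?D = 0")
proof -
  have "?D * x = 0" "?D * y = 0" "?D * z = 0"
    using assms(1-3) by algebra+
  then show ?thesis
    using assms(4) by auto
qed

text \<open>With M the coordinate matrix and J = diag(1, 1, -1), the Gram determinant is det (M J
  M^T) = - (det M)^2.\<close>

lemma gram_det_eq_0:
  fixes l1 :: "'a::field"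
  assumes "l1 * (m2 * n3 - n2 * m3) - m1 * (l2 * n3 - n2 * l3) + n1 * (l2 * m3 - m2 * l3) = 0"
  defines "q1 \<equiv> l1^2 + m1^2 - n1^2" and "q2 \<equiv> l2^2 + m2^2 - n2^2" and "q3 \<equiv> l3^2 + m3^2 - n3^2"
    and "b1 \<equiv> l2 * l3 + m2 * m3 - n2 * n3" and "b2 \<equiv> l1 * l3 + m1 * m3 - n1 * n3"
    and "b3 \<equiv> l1 * l2 + m1 * m2 - n1 * n2"
  shows "q1 * q2 * q3 + 2 * b1 * b2 * b3 = q1 * b1^2 + q2 * b2^2 + q3 * b3^2"
  using assms(1) unfolding assms(2-) by algebra

lemma triple_spread_of_gram:
  fixes q1 :: "'a::field"
  assumes "q1 \<noteq> 0" "q2 \<noteq> 0" "q3 \<noteq> 0"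
    and gram: "q1 * q2 * q3 + 2 * b1 * b2 * b3 = q1 * b1^2 + q2 * b2^2 + q3 * b3^2"
  defines "S1 \<equiv> 1 - b1^2 / (q2 * q3)" and "S2 \<equiv> 1 - b2^2 / (q1 * q3)"
    and "S3 \<equiv> 1 - b3^2 / (q1 * q2)"
  shows "(S1 + S2 + S3)^2 = 2 * (S1^2 + S2^2 + S3^2) + 4 * S1 * S2 * S3"
proof -
  define C1 C2 C3 where "C1 = b1^2 / (q2 * q3)" and "C2 = b2^2 / (q1 * q3)"
    and "C3 = b3^2 / (q1 * q2)"
  have C: "C1 * (q2 * q3) = b1^2" "C2 * (q1 * q3) = b2^2" "C3 * (q1 * q2) = b3^2"
    using assms(1-3) by (simp_all add: C1_def C2_def C3_def)
  \<comment> \<open>By \<open>C\<close>, each \<open>qi * bi^2\<close> in \<open>gram\<close> equals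
    \<open>q1 * q2 * q3 * Ci\<close>.\<close>
  have "(q1 * q2 * q3) * (1 - C1 - C2 - C3) = - (2 * b1 * b2 * b3)"
    using C gram by algebra
  then have "(q1 * q2 * q3)^2 * (1 - C1 - C2 - C3)^2 = 4 * b1^2 * b2^2 * b3^2"
    by algebra
  also have "\<dots> = (q1 * q2 * q3)^2 * (4 * C1 * C2 * C3)"
    unfolding C[symmetric] by algebra
  finally have "(1 - C1 - C2 - C3)^2 = 4 * C1 * C2 * C3"
    using assms(1-3) by simp
  moreover have "S1 = 1 - C1" "S2 = 1 - C2" "S3 = 1 - C3"
    by (simp_all add: S1_def S2_def S3_def C1_def C2_def C3_def)
  \<comment> \<open>Put s = \<open>S1 + S2 + S3\<close>. The identity reads (s - 2)^2 = 4 (1 -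
    \<open>S1\<close>) (1 - \<open>S2\<close>) (1 - \<open>S3\<close>); constant and linear terms
    cancel on expansion.\<close>
  ultimately show ?thesis
    by algebra
qed

lemma triple_spread:
  fixes L1 L2 L3 :: "'a::field line"
  assumes "\<not> null_line L1" "\<not> null_line L2" "\<not> null_line L3"
    and "passes_through L1 a" "passes_through L2 a" "passes_through L3 a"
  shows "(spread L2 L3 + spread L1 L3 + spread L1 L2)^2 =
    2 * ((spread L2 L3)^2 + (spread L1 L3)^2 + (spread L1 L2)^2)
      + 4 * spread L2 L3 * spread L1 L3 * spread L1 L2"
  using assms
proof (transfer, clarify)
  fix l1 m1 n1 l2 m2 n2 l3 m3 n3 x y z :: 'a
  assume a: "proportional3 (x, y, z) (x, y, z)"
    and q: "l1^2 + m1^2 - n1^2 \<noteq> 0" "l2^2 + m2^2 - n2^2 \<noteq> 0" "l3^2 + m3^2 - n3^2 \<noteq> 0"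
    and e: "l1 * x + m1 * y - n1 * z = 0" "l2 * x + m2 * y - n2 * z = 0"
      "l3 * x + m3 * y - n3 * z = 0"
  \<comment> \<open>In the partial quotient, being related to itself is exactly being a nonzero
    triple.\<close>
  have "(x, y, z) \<noteq> (0, 0, 0)"
    using a by (simp add: proportional3_def)
  note triple_spread_of_gram[OF q gram_det_eq_0[OF concurrent_det_eq_0[OF e this]]]
  then show "(1 - (l2 * l3 + m2 * m3 - n2 * n3)^2 / ((l2^2 + m2^2 - n2^2) * (l3^2 + m3^2 - n3^2)) +
      (1 - (l1 * l3 + m1 * m3 - n1 * n3)^2 / ((l1^2 + m1^2 - n1^2) * (l3^2 + m3^2 - n3^2))) +
      (1 - (l1 * l2 + m1 * m2 - n1 * n2)^2 / ((l1^2 + m1^2 - n1^2) * (l2^2 + m2^2 - n2^2))))^2 =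
    2 * ((1 - (l2 * l3 + m2 * m3 - n2 * n3)^2 / ((l2^2 + m2^2 - n2^2) * (l3^2 + m3^2 - n3^2)))^2 +
      (1 - (l1 * l3 + m1 * m3 - n1 * n3)^2 / ((l1^2 + m1^2 - n1^2) * (l3^2 + m3^2 - n3^2)))^2 +
      (1 - (l1 * l2 + m1 * m2 - n1 * n2)^2 / ((l1^2 + m1^2 - n1^2) * (l2^2 + m2^2 - n2^2)))^2) +
    4 * (1 - (l2 * l3 + m2 * m3 - n2 * n3)^2 / ((l2^2 + m2^2 - n2^2) * (l3^2 + m3^2 - n3^2))) *
      (1 - (l1 * l3 + m1 * m3 - n1 * n3)^2 / ((l1^2 + m1^2 - n1^2) * (l3^2 + m3^2 - n3^2))) *
      (1 - (l1 * l2 + m1 * m2 - n1 * n2)^2 / ((l1^2 + m1^2 - n1^2) * (l2^2 + m2^2 - n2^2)))" .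
qed

theorem theorem39:
  fixes L1 L2 L3 :: "'a::field line" and S1 S2 S3 :: 'a
  assumes "CHAR('a) \<noteq> 2"
    and "\<not> null_line L1" and "\<not> null_line L2" and "\<not> null_line L3"
    and "concurrent3 L1 L2 L3"
    and "S1 = spread L2 L3" and "S2 = spread L1 L3" and "S3 = spread L1 L2"
  shows "(S1 + S2 + S3)^2 = 2 * (S1^2 + S2^2 + S3^2) + 4 * S1 * S2 * S3"
  using assms(2-) triple_spread unfolding concurrent3_def by blast

end
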